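(* Let $u\ge1$ be an integer, $0<p\le1$, $q=1-p$, and consider the single-player pile game with boundary with set of choices $R=\{1,-u\}$, with generating functions $G_{n,s}(x)$, $0\le s\le n$. For $0\le s\le n$ write $G_{n,s}(x)=\dfrac{P_{n,s}(x)}{Q_n(x)}$, where $Q_n(x)$ is the common denominator (independent of $s$), normalized so that the numerator of $G_{n,0}(x)$ is $P_{n,0}(x)=(px)^n$, and the $P_{n,s}(x)$ are polynomials. Then $Q_n(x)$ satisfies $$Q_n(x)=Q_{n-1}(x)-q\,p^u x^{u+1}\,Q_{n-u-1}(x)\qquad(n\ge u+1).$$
   Context: Single-player pile game with boundary, $R=\{1,-u\}$: the player starts with $s$ chips, $0\le s\le n$. In each turn, independently, the number of chips $c$ is replaced by $c+1$ with probability $p$ and by $\max(0,c-u)$ with probability $q=1-p$. The game ends when the player first has $n$ chips (at turn $0$ if $s=n$). $B_n(k,s)$ is the probability that the game ends at the $k$-th turn, and $G_{n,s}(x)=\sum_{k\ge0}B_n(k,s)x^k$. In particular $G_{n,n}(x)=1$ for all $n\ge0$. The functions $G_{n,s}(x)$, $0\le s\le n$, are rational with a common denominator. *)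

theory Defs
  imports "HOL-Probability.Probability" "HOL-Computational_Algebra.Polynomial_FPS"
begin

text \<open>
  A run of the pile game is driven by an infinite sequence of independent coin tosses, each
  \<open>True\<close> with probability \<open>p\<close>. Losing \<open>u\<close> chips is the truncated subtraction on \<^typ>\<open>nat\<close>,
  that is, \<open>max(0, c - u)\<close>. The pile is tracked also after the game has ended; this does not
  affect the first turn at which it reaches \<open>n\<close> chips.
\<close>

definition tosses :: "real \<Rightarrow> bool stream measure" where
  "tosses p = stream_space (measure_pmf (bernoulli_pmf p))"

primrec chips :: "nat \<Rightarrow> nat \<Rightarrow> bool stream \<Rightarrow> nat \<Rightarrow> nat" where
  "chips u s \<omega> 0 = s"
| "chips u s \<omega> (Suc t) = (if \<omega> !! t then chips u s \<omega> t + 1 else chips u s \<omega> t - u)"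

definition ends_at :: "nat \<Rightarrow> nat \<Rightarrow> nat \<Rightarrow> bool stream \<Rightarrow> nat \<Rightarrow> bool" where
  "ends_at u n s \<omega> k \<longleftrightarrow> chips u s \<omega> k = n \<and> (\<forall>j<k. chips u s \<omega> j \<noteq> n)"

definition B :: "real \<Rightarrow> nat \<Rightarrow> nat \<Rightarrow> nat \<Rightarrow> nat \<Rightarrow> real" where
  "B p u n k s = measure (tosses p) {\<omega> \<in> space (tosses p). ends_at u n s \<omega> k}"

definition G :: "real \<Rightarrow> nat \<Rightarrow> nat \<Rightarrow> nat \<Rightarrow> real fps" where
  "G p u n s = Abs_fps (\<lambda>k. B p u n k s)"

text \<open>
  The equations \<open>G\<^sub>n\<^sub>,\<^sub>s(x) = P\<^sub>s(x) / Q(x)\<close> for \<open>0 \<le> s \<le> n\<close>, with \<open>Q\<close> normalized by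
  \<open>P\<^sub>0(x) = (p x)\<^sup>n\<close>. They are stated in the integral domain of formal power series with the
  nonzero denominator cleared, so that nothing depends on the conventions for dividing by a
  series whose constant term vanishes. The values \<open>P s\<close> for \<open>s > n\<close> are irrelevant.
\<close>

definition normalized_fractions ::
    "real \<Rightarrow> nat \<Rightarrow> nat \<Rightarrow> (nat \<Rightarrow> real poly) \<Rightarrow> real poly \<Rightarrow> bool" where
  "normalized_fractions p u n P Q \<longleftrightarrow>
     Q \<noteq> 0 \<and> (\<forall>s\<le>n. G p u n s * fps_of_poly Q = fps_of_poly (P s)) \<and> P 0 = (monom p 1) ^ n"

lemma measurable_chips: "(\<lambda>\<omega>. chips u s \<omega> k) \<in> tosses p \<rightarrow>\<^sub>M count_space UNIV"
proof (induction k)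
  case (Suc k)
  have [measurable]: "(\<lambda>\<omega>. \<omega> !! k) \<in> tosses p \<rightarrow>\<^sub>M count_space UNIV"
    unfolding tosses_def by (rule measurable_compose[OF measurable_snth]) simp
  note [measurable] = Suc.IH
  show ?case by simp
qed simp

lemma ends_at_in_sets: "{\<omega> \<in> space (tosses p). ends_at u n s \<omega> k} \<in> sets (tosses p)"
proof -
  note [measurable] = measurable_chips
  show ?thesis unfolding ends_at_def by measurable
qed

end

theory Submission
  imports Defs
begin

text \<open>
  First-step analysis gives \<open>G\<^sub>n\<^sub>,\<^sub>s = p x G\<^sub>n\<^sub>,\<^sub>s\<^sub>+\<^sub>1 + q x G\<^sub>n\<^sub>,\<^sub>r\<close> with \<open>r = max(0, s - u)\<close>, for \<open>s < n\<close>.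
  Solving this for
  \<open>G\<^sub>n\<^sub>,\<^sub>s\<^sub>+\<^sub>1\<close> expresses every \<open>(p x)\<^sup>s G\<^sub>n\<^sub>,\<^sub>s\<close> as \<open>D\<^sub>s G\<^sub>n\<^sub>,\<^sub>0\<close>, where the polynomials \<open>D\<^sub>s\<close> are defined
  recursively and do not depend on \<open>n\<close>. At \<open>s = n\<close>, where \<open>G\<^sub>n\<^sub>,\<^sub>n = 1\<close>, this reads
  \<open>(p x)\<^sup>n = D\<^sub>n G\<^sub>n\<^sub>,\<^sub>0\<close>, so that \<open>D\<^sub>n\<close> is the normalized denominator, and the
  recursion defining \<open>D\<close> is the claimed one.
\<close>

lemma chips_Stream: "chips u s (b ## \<omega>) (Suc k) = chips u (if b then s + 1 else s - u) \<omega> k"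
  by (induction k) simp_all

lemma ends_at_0: "ends_at u n s \<omega> 0 \<longleftrightarrow> s = n"
  by (simp add: ends_at_def)

lemma not_ends_at_Suc_self: "\<not> ends_at u n n \<omega> (Suc k)"
  by (auto simp: ends_at_def)

lemma ends_at_Stream:
  assumes "s \<noteq> n"
  shows "ends_at u n s (b ## \<omega>) (Suc k) \<longleftrightarrow> ends_at u n (if b then s + 1 else s - u) \<omega> k"
  \<comment> \<open>\<open>All_less_Suc2\<close> splits off turn 0, where
    \<open>s \<noteq> n\<close> rules out an end.\<close>
  unfolding ends_at_def All_less_Suc2 chips_Stream using assms by simp

lemma space_tosses [simp]: "space (tosses p) = UNIV"
  by (simp add: tosses_def space_stream_space)

lemma prob_space_tosses: "prob_space (tosses p)"
  unfolding tosses_def by (rule prob_space.prob_space_stream_space) (rule prob_space_measure_pmf)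

lemma B_0: "B p u n 0 s = (if s = n then 1 else 0)"
  using prob_space.prob_space[OF prob_space_tosses] by (simp add: B_def ends_at_0)

lemma B_Suc_self: "B p u n (Suc k) n = 0"
  by (simp add: B_def not_ends_at_Suc_self)

text \<open>Conditioning on the first toss: the remaining tosses are again distributed as
  \<open>tosses p\<close>, and \<open>s \<noteq> n\<close> means that the game is not over at turn
  0.\<close>

lemma B_Suc:
  assumes "0 \<le> p" "p \<le> 1" "s \<noteq> n"
  shows "B p u n (Suc k) s = p * B p u n k (s + 1) + (1 - p) * B p u n k (s - u)"
proof -
  interpret prob_space "tosses p" by (rule prob_space_tosses)
  have B: "emeasure (tosses p) {\<omega>. ends_at u n r \<omega> j} = ennreal (B p u n j r)" for r j
    by (simp add: B_def emeasure_eq_measure)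
  have nonneg: "0 \<le> B p u n j r" for r j
    by (simp add: B_def)
  have "{\<omega>. ends_at u n s \<omega> (Suc k)} \<in> sets (stream_space (measure_pmf (bernoulli_pmf p)))"
    using ends_at_in_sets[of p u n s "Suc k"] by (simp add: tosses_def[symmetric])
  from prob_space.emeasure_stream_space[OF prob_space_measure_pmf this]
  have "emeasure (tosses p) {\<omega>. ends_at u n s \<omega> (Suc k)} =
    (\<integral>\<^sup>+b. emeasure (tosses p) {\<omega>. ends_at u n (if b then s + 1 else s - u) \<omega> k}
      \<partial>measure_pmf (bernoulli_pmf p))"
    by (simp add: tosses_def[symmetric] ends_at_Stream[OF assms(3)])
  also have "\<dots> = ennreal (p * B p u n k (s + 1) + (1 - p) * B p u n k (s - u))"
    using assms nonneg by (simp add: B ennreal_mult ennreal_plus mult.commute)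
  finally show ?thesis
    unfolding B using assms nonneg by (subst (asm) ennreal_inj) auto
qed

lemma G_self: "G p u n n = 1"
proof (rule fps_ext)
  fix k show "fps_nth (G p u n n) k = fps_nth 1 k"
    by (cases k) (simp_all add: G_def B_0 B_Suc_self)
qed

lemma G_step:
  assumes "0 \<le> p" "p \<le> 1" "s \<noteq> n"
  shows "G p u n s =
    fps_of_poly (monom p 1) * G p u n (s + 1) + fps_of_poly (monom (1 - p) 1) * G p u n (s - u)"
proof (rule fps_ext)
  fix k show "fps_nth (G p u n s) k = fps_nth (fps_of_poly (monom p 1) * G p u n (s + 1) +
      fps_of_poly (monom (1 - p) 1) * G p u n (s - u)) k"
    using assms by (cases k)
      (simp_all add: fps_of_poly_monom G_def B_0 B_Suc mult.assoc fps_mult_left_const_nth)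
qed

text \<open>The exponent \<open>min s u\<close> is \<open>s - (s - u)\<close>, the number of chips
  actually lost from a pile of \<open>s\<close>. Thus one equation also covers piles cut off at
  0.\<close>

fun denom :: "real \<Rightarrow> nat \<Rightarrow> nat \<Rightarrow> real poly" where
  "denom p u 0 = 1"
| "denom p u (Suc s) = denom p u s - monom (1 - p) 1 * monom p 1 ^ min s u * denom p u (s - u)"

lemma coeff_0_denom: "coeff (denom p u s) 0 = 1"
  by (induction s) (simp_all add: coeff_mult_0 coeff_0_power)

lemma denom_nonzero: "denom p u s \<noteq> 0"
  using coeff_0_denom[of p u s] by auto

text \<open>Here \<open>u \<le> n - 1\<close>, so the loss is not truncated and \<open>min\<close>
  evaluates to \<open>u\<close>.\<close>

lemma denom_rec:
  assumes "u + 1 \<le> n"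
  shows "denom p u n =
    denom p u (n - 1) - monom ((1 - p) * p ^ u) (u + 1) * denom p u (n - u - 1)"
proof -
  from assms obtain m where "n = Suc m" "u \<le> m"
    by (cases n) auto
  then show ?thesis
    by (simp add: monom_power mult_monom min_absorb2)
qed

text \<open>Strong induction, since the equation at \<open>Suc t\<close> rests on those at
  \<open>t\<close> and \<open>t - u\<close>. The powers of \<open>p x\<close> stay as factors
  because \<open>x\<close> has no inverse among power series.\<close>

lemma power_mult_G_eq:
  assumes "0 \<le> p" "p \<le> 1" "s \<le> n"
  shows "fps_of_poly (monom p 1 ^ s) * G p u n s = fps_of_poly (denom p u s) * G p u n 0"
  using assms(3)
proof (induction s rule: less_induct)
  case (less s)
  show ?case
  proof (cases s)
    case (Suc t)
    define X where "X = fps_of_poly (monom p 1)"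
    define Y where "Y = fps_of_poly (monom (1 - p) 1)"
    have IH: "X ^ t * G p u n t = fps_of_poly (denom p u t) * G p u n 0"
      "X ^ (t - u) * G p u n (t - u) = fps_of_poly (denom p u (t - u)) * G p u n 0"
      using less Suc by (simp_all add: X_def flip: fps_of_poly_power)
    have "G p u n t = X * G p u n (Suc t) + Y * G p u n (t - u)"
      using G_step[of p t n u] assms less.prems Suc by (simp add: X_def Y_def)
    then have "X ^ Suc t * G p u n (Suc t) = X ^ t * G p u n t - Y * (X ^ t * G p u n (t - u))"
      by (simp add: algebra_simps)
    \<comment> \<open>This exposes the power of \<open>X\<close> required by the induction
      hypothesis at \<open>t - u\<close>.\<close>
    moreover have "X ^ t = X ^ min t u * X ^ (t - u)"
      by (simp add: min_def flip: power_add)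
    ultimately have "X ^ Suc t * G p u n (Suc t) =
      X ^ t * G p u n t - Y * (X ^ min t u * (X ^ (t - u) * G p u n (t - u)))"
      by (simp only: mult.assoc)
    also have "\<dots> =
      (fps_of_poly (denom p u t) - Y * X ^ min t u * fps_of_poly (denom p u (t - u))) * G p u n 0"
      by (simp only: IH mult.assoc left_diff_distrib)
    finally show ?thesis
      by (simp add: Suc X_def Y_def fps_of_poly_power fps_of_poly_mult fps_of_poly_diff)
  qed simp
qed

lemma G_0_mult_denom:
  assumes "0 \<le> p" "p \<le> 1"
  shows "G p u n 0 * fps_of_poly (denom p u n) = fps_of_poly (monom p 1 ^ n)"
  using power_mult_G_eq[OF assms order_refl, of n u] by (simp add: G_self mult.commute)

text \<open>Multiplying \<open>power_mult_G_eq\<close> by the denominator and applying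
  \<open>G_0_mult_denom\<close> leaves a common factor \<open>(p x)^s\<close>, which cancels because
  \<open>0 < p\<close>.\<close>

lemma normalized_fractions_denom:
  assumes "0 < p" "p \<le> 1"
  shows "normalized_fractions p u n (\<lambda>s. monom p 1 ^ (n - s) * denom p u s) (denom p u n)"
  unfolding normalized_fractions_def
proof (intro conjI allI impI)
  fix s assume "s \<le> n"
  let ?X = "\<lambda>i. fps_of_poly (monom p 1 ^ i)"
  have "?X s * (G p u n s * fps_of_poly (denom p u n)) =
    fps_of_poly (denom p u s) * (G p u n 0 * fps_of_poly (denom p u n))"
    using power_mult_G_eq[of p s n u] assms \<open>s \<le> n\<close> by (simp add: mult.assoc[symmetric])
  also have "\<dots> = fps_of_poly (denom p u s) * ?X (s + (n - s))"
    using G_0_mult_denom[of p u n] assms \<open>s \<le> n\<close> by simp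
  also have "\<dots> = ?X s * fps_of_poly (monom p 1 ^ (n - s) * denom p u s)"
    unfolding power_add fps_of_poly_mult by (simp only: mult_ac)
  finally show "G p u n s * fps_of_poly (denom p u n) =
      fps_of_poly (monom p 1 ^ (n - s) * denom p u s)"
    using assms by (simp add: monom_eq_0_iff)
qed (simp_all add: denom_nonzero)

text \<open>The case \<open>s = 0\<close> alone determines \<open>Q\<close>: its numerator
  \<open>(p x)^n\<close> is nonzero, hence so is \<open>G p u n 0\<close>, which can be cancelled in
  the integral domain of power series.\<close>

lemma normalized_fractions_imp_denom:
  assumes "0 < p" "p \<le> 1" "normalized_fractions p u n P Q"
  shows "Q = denom p u n"
proof -
  have *: "G p u n 0 * fps_of_poly (denom p u n) = fps_of_poly (monom p 1 ^ n)"
    using assms by (intro G_0_mult_denom) auto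
  then have "G p u n 0 \<noteq> 0"
    using assms(1) by (auto simp: monom_eq_0_iff)
  moreover have "G p u n 0 * fps_of_poly Q = G p u n 0 * fps_of_poly (denom p u n)"
    using assms(3) * by (simp add: normalized_fractions_def)
  ultimately show ?thesis
    by simp
qed

theorem corollary10:
  fixes p q :: real and u :: nat
  assumes "u \<ge> 1" and "0 < p" and "p \<le> 1" and "q = 1 - p"
  shows "(\<exists>P Q. \<forall>n. normalized_fractions p u n (P n) (Q n)) \<and>
    (\<forall>P Q. (\<forall>n. normalized_fractions p u n (P n) (Q n)) \<longrightarrow>
      (\<forall>n\<ge>u + 1. Q n = Q (n - 1) - monom (q * p ^ u) (u + 1) * Q (n - u - 1)))"
proof (intro conjI allI impI)
  show "\<exists>P Q. \<forall>n. normalized_fractions p u n (P n) (Q n)"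
    using normalized_fractions_denom[OF assms(2,3)]
    by (intro exI[of _ "\<lambda>n s. monom p 1 ^ (n - s) * denom p u s"] exI[of _ "denom p u"]) simp
next
  fix P Q n
  assume "\<forall>n. normalized_fractions p u n (P n) (Q n)" and "u + 1 \<le> n"
  moreover from this(1) have "Q = denom p u"
    using normalized_fractions_imp_denom[OF assms(2,3)] by blast
  ultimately show "Q n = Q (n - 1) - monom (q * p ^ u) (u + 1) * Q (n - u - 1)"
    using denom_rec[of u n p] assms(4) by simp
qed

end
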